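(* Fix $\delta\in(0,1/4)$ and $\epsilon_{\max}\in(0,1/3]$, and assume that $\sigma^2>0$ is unknown. There is a constant $c>0$ depending only on $\delta$ and $\epsilon_{\max}$ such that the following holds. For any confidence interval $\widehat{\mathrm{CI}}$ (computed from $n$ i.i.d. observations, using neither $\sigma$ nor $\varepsilon$) and any function $r(n,\sigma,\varepsilon)$ that satisfy $$\inf_{\theta\in\mathbb R,\,\sigma^2>0}\ \inf_{\varepsilon\in[0,\epsilon_{\max}],\,Q}P^n_{\theta,\sigma,\varepsilon,Q}\big(\theta\in\widehat{\mathrm{CI}}\big)\ge1-\delta,\qquad \inf_{\theta\in\mathbb R,\,\sigma^2>0}\ \inf_{\varepsilon\in[0,\epsilon_{\max}],\,Q}P^n_{\theta,\sigma,\varepsilon,Q}\big(|\widehat{\mathrm{CI}}|\le r(n,\sigma,\varepsilon)\big)\ge1-\delta,$$ it must hold that $$r(n,\sigma,\varepsilon)\ \ge\ c\,\sigma\, n^{-1/8}$$ for all $(n,\sigma,\varepsilon)$ with $\varepsilon\in[0,\epsilon_{\max}]$.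
   Context: For $I\subseteq\mathbb R$, $|I|=\sup I-\inf I$ denotes its diameter (length). Model (Efron's Gaussian two-groups model). For $\theta\in\mathbb R$, $\sigma>0$, $\varepsilon\in[0,1/2)$ and $Q$ an arbitrary probability distribution on $\mathbb R$, $$P_{\theta,\sigma,\varepsilon,Q}=(1-\varepsilon)\,\mathcal N(\theta,\sigma^2)+\varepsilon\, Q*\mathcal N(0,\sigma^2),$$ and $P^n_{\theta,\sigma,\varepsilon,Q}$ is the law of i.i.d. $X_1,\dots,X_n\sim P_{\theta,\sigma,\varepsilon,Q}$. Infima over $Q$ range over all probability distributions on $\mathbb R$. *)

theory Defs
  imports "HOL-Probability.Probability"
begin

definition gaussian :: "real \<Rightarrow> real \<Rightarrow> real measure" where
  "gaussian \<theta> \<sigma> = density lborel (normal_density \<theta> \<sigma>)"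

definition mixture :: "real \<Rightarrow> real measure \<Rightarrow> real measure \<Rightarrow> real measure" where
  "mixture \<epsilon> M N = measure_of UNIV (sets borel)
     (\<lambda>A. ennreal (1 - \<epsilon>) * emeasure M A + ennreal \<epsilon> * emeasure N A)"

definition two_groups :: "real \<Rightarrow> real \<Rightarrow> real \<Rightarrow> real measure \<Rightarrow> real measure" where
  "two_groups \<theta> \<sigma> \<epsilon> Q = mixture \<epsilon> (gaussian \<theta> \<sigma>) (Q \<star> gaussian 0 \<sigma>)"

definition two_groups_sample ::
    "nat \<Rightarrow> real \<Rightarrow> real \<Rightarrow> real \<Rightarrow> real measure \<Rightarrow> (nat \<Rightarrow> real) measure" where
  "two_groups_sample n \<theta> \<sigma> \<epsilon> Q = PiM {..<n} (\<lambda>_. two_groups \<theta> \<sigma> \<epsilon> Q)"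

text \<open>The length is extended-real valued, as confidence intervals may be unbounded.
  The case distinction is needed because the \<^typ>\<open>ereal\<close> supremum of the empty set is
  minus infinity.\<close>

definition set_length :: "real set \<Rightarrow> ereal" where
  "set_length I = (if I = {} then 0 else (SUP x\<in>I. ereal x) - (INF x\<in>I. ereal x))"

text \<open>A confidence interval is a function of the data alone; the measurability clauses say that
  the coverage and length events are events.\<close>

definition confidence_interval :: "nat \<Rightarrow> ((nat \<Rightarrow> real) \<Rightarrow> real set) \<Rightarrow> bool" where
  "confidence_interval n CI \<longleftrightarrow>
     (\<forall>x \<in> space (PiM {..<n} (\<lambda>_. borel)). is_interval (CI x)) \<and>
     (\<forall>\<theta>. Measurable.pred (PiM {..<n} (\<lambda>_. borel)) (\<lambda>x. \<theta> \<in> CI x)) \<and>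
     (\<lambda>x. set_length (CI x)) \<in> borel_measurable (PiM {..<n} (\<lambda>_. borel))"

lemma space_mixture [simp]: "space (mixture \<epsilon> M N) = UNIV"
  by (simp add: mixture_def)

lemma sets_mixture [simp, measurable_cong]: "sets (mixture \<epsilon> M N) = sets borel"
  unfolding mixture_def by (metis sets.sets_measure_of_eq space_borel)

lemma emeasure_mixture:
  assumes M: "sets M = sets borel" and N: "sets N = sets borel" and A: "A \<in> sets borel"
  shows "emeasure (mixture \<epsilon> M N) A = ennreal (1 - \<epsilon>) * emeasure M A + ennreal \<epsilon> * emeasure N A"
proof (rule emeasure_measure_of[OF mixture_def])
  let ?f = "\<lambda>A. ennreal (1 - \<epsilon>) * emeasure M A + ennreal \<epsilon> * emeasure N A"
  show "positive (sets (mixture \<epsilon> M N)) ?f"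
    by (simp add: positive_def)
  show "countably_additive (sets (mixture \<epsilon> M N)) ?f"
  proof (rule countably_additiveI)
    fix B :: "nat \<Rightarrow> real set"
    assume "range B \<subseteq> sets (mixture \<epsilon> M N)" and d: "disjoint_family B"
    then have B: "range B \<subseteq> sets M" "range B \<subseteq> sets N"
      by (simp_all add: M N)
    show "(\<Sum>i. ?f (B i)) = ?f (\<Union>i. B i)"
      by (simp add: suminf_add[symmetric] ennreal_suminf_cmult
          suminf_emeasure[OF B(1) d] suminf_emeasure[OF B(2) d])
  qed
qed (use A in auto)

lemma prob_space_mixture:
  assumes "prob_space M" "prob_space N" and M: "sets M = sets borel" and N: "sets N = sets borel"
    and \<epsilon>: "0 \<le> \<epsilon>" "\<epsilon> \<le> 1"
  shows "prob_space (mixture \<epsilon> M N)"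
proof
  have "emeasure M UNIV = 1" "emeasure N UNIV = 1"
    using assms(1,2)[THEN prob_space.emeasure_space_1] M N
    by (metis sets_eq_imp_space_eq space_borel)+
  then show "emeasure (mixture \<epsilon> M N) (space (mixture \<epsilon> M N)) = 1"
    using \<epsilon> by (simp add: emeasure_mixture[OF M N] ennreal_plus[symmetric] del: ennreal_plus)
qed

lemma prob_space_two_groups:
  assumes \<sigma>: "0 < \<sigma>" and \<epsilon>: "0 \<le> \<epsilon>" "\<epsilon> \<le> 1" and Q: "Q \<in> space (prob_algebra borel)"
  shows "prob_space (two_groups \<theta> \<sigma> \<epsilon> Q)"
proof -
  have G: "prob_space (gaussian \<mu> \<sigma>)" "sets (gaussian \<mu> \<sigma>) = sets borel" for \<mu>
    using prob_space_normal_density[OF \<sigma>] by (simp_all add: gaussian_def)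
  have Q': "prob_space Q" and [measurable_cong]: "sets Q = sets borel"
    using Q by (simp_all add: space_prob_algebra)
  note [measurable_cong] = G(2)
  interpret Q: prob_space Q by (rule Q')
  interpret G: prob_space "gaussian 0 \<sigma>" by (rule G)
  interpret pair_prob_space Q "gaussian 0 \<sigma>" ..
  have "prob_space (Q \<star> gaussian 0 \<sigma>)"
    unfolding convolution_def by (rule prob_space_distr) measurable
  then show ?thesis
    unfolding two_groups_def by (intro prob_space_mixture G \<epsilon>) simp_all
qed

end

theory Submission
  imports Defs "HOL-Real_Asymp.Real_Asymp"
begin

text \<open>
This is a two-point argument. Take a model with centre \<open>0\<close> and one with centre \<open>\<theta>\<close> that the sample can
hardly tell apart. Under the first model the interval then covers \<open>0\<close>, respects its length bound, and
also covers \<open>\<theta>\<close>, each with probability high enough for the three events to occur together; so the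
length bound is at least \<open>\<theta>\<close>.

The first model is \<open>gaussian 0 \<sigma>\<close>. It occurs at every contamination level, as the contaminating effects
may all be zero, so the length bound \<open>r n \<sigma> \<epsilon>\<close> is in force there for every \<open>\<epsilon>\<close>.

The second model uses that \<open>\<sigma>\<close> is unknown. For small \<open>q\<close>, \<open>gaussian 0 \<sigma>\<close> is a location mixture of
normal distributions with the smaller variance \<open>\<sigma>\<^sup>2 * (1 - q)\<close>, mixed by a centred normal distribution
with variance \<open>\<sigma>\<^sup>2 * q\<close>. Replace this mixing distribution by a three-point distribution with the
same first three moments that has an atom of mass \<open>1 - \<epsilon>max\<close> away from zero, at distance
\<open>\<theta>\<close> proportional to \<open>\<sigma> * sqrt q\<close>. The result is a two-groups model with centre \<open>\<theta>\<close>. Such points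
exist for every contamination level in \<open>(0, 1/2)\<close>, by \<open>contaminated_atom_matches_gaussian_moments\<close>.

The chi-square divergence of the second model from the first is a quadratic form in the Mehler kernel
(\<open>gaussian_location_mixture_square\<close>), whose expansion in \<open>q\<close> is diagonal in Hermite polynomials.
Matching three moments removes the orders one to three (\<open>moment_matched_mehler_form\<close>), so the
divergence is \<open>O(q ^ 4)\<close>. A sample of size \<open>n\<close> cannot separate the models when \<open>n * q ^ 4\<close> is small
(\<open>product_density_event_bound\<close>), which permits \<open>q\<close> of order \<open>n powr (-1/4)\<close> and hence \<open>\<theta>\<close> of order
\<open>\<sigma> * n powr (-1/8)\<close>.\<close>

section \<open>The Mehler kernel\<close>

text \<open>The Mehler kernel \<open>\<Sum>k. q ^ k * He\<^sub>k z * He\<^sub>k w / k!\<close> in closed form, where \<open>He\<^sub>k\<close> are the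
probabilists' Hermite polynomials.\<close>
definition mehler :: "real \<Rightarrow> real \<Rightarrow> real \<Rightarrow> real" where
  "mehler q z w = exp ((2 * q * z * w - q\<^sup>2 * (z\<^sup>2 + w\<^sup>2)) / (2 * (1 - q\<^sup>2))) / sqrt (1 - q\<^sup>2)"

lemma cmult_in_bigo:
  fixes c :: real
  shows "f \<in> O[F](g) \<Longrightarrow> (\<lambda>x. c * f x) \<in> O[F](g)"
  by (cases "c = 0") auto

lemma exp_cubic_remainder:
  "(\<lambda>x::real. exp x - (1 + x + x\<^sup>2 / 2 + x ^ 3 / 6)) \<in> O[nhds 0](\<lambda>x. x ^ 4)"
proof -
  have "(\<lambda>x::real. exp x - (1 + x + x\<^sup>2 / 2 + x ^ 3 / 6)) \<in> O[at 0](\<lambda>x. x ^ 4)"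
    by real_asymp
  then show ?thesis
    unfolding bigo_def by (auto simp: eventually_nhds_conv_at)
qed

text \<open>The terms of order below four are those of the Hermite series with
\<open>He\<^sub>1 z = z\<close>, \<open>He\<^sub>2 z = z\<^sup>2 - 1\<close> and \<open>He\<^sub>3 z = z ^ 3 - 3 * z\<close>. The kernel depends on \<open>z\<close> and \<open>w\<close> only
through \<open>p = z * w\<close> and \<open>s = z\<^sup>2 + w\<^sup>2\<close>, and its exponent is \<open>O(q)\<close>; so the exponential may be replaced by
its cubic Taylor polynomial, and then every coefficient of a monomial in \<open>p\<close> and \<open>s\<close> is a function of
\<open>q\<close> alone that can be expanded separately.\<close>
lemma mehler_expansion:
  "(\<lambda>q. mehler q z w - (1 + q * (z * w) + q\<^sup>2 * ((z\<^sup>2 - 1) * (w\<^sup>2 - 1)) / 2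
    + q ^ 3 * ((z ^ 3 - 3 * z) * (w ^ 3 - 3 * w)) / 6)) \<in> O[at_right 0](\<lambda>q. q ^ 4)"
proof -
  define p s where "p = z * w" and "s = z\<^sup>2 + w\<^sup>2"
  define A u v :: "real \<Rightarrow> real" where "A = (\<lambda>q. 1 / sqrt (1 - q\<^sup>2))"
    and "u = (\<lambda>q. q / (1 - q\<^sup>2))" and "v = (\<lambda>q. q\<^sup>2 / (2 * (1 - q\<^sup>2)))"
  define E where "E = (\<lambda>q. p * u q - s * v q)"
  define R where "R = (\<lambda>x::real. exp x - (1 + x + x\<^sup>2 / 2 + x ^ 3 / 6))"
  have u: "u \<in> O[at_right 0](\<lambda>q. q)" and v: "v \<in> O[at_right 0](\<lambda>q. q)"
    unfolding u_def v_def by real_asymp+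
  have E: "E \<in> O[at_right 0](\<lambda>q. q)"
    unfolding E_def by (rule sum_in_bigo cmult_in_bigo u v)+
  have lim: "((\<lambda>q. p * u q - s * v q) \<longlongrightarrow> p * 0 - s * 0) (at_right 0)"
    by (intro tendsto_intros; unfold u_def v_def; real_asymp)
  have "(\<lambda>q. R (E q)) \<in> O[at_right 0](\<lambda>q. E q ^ 4)"
    using landau_o.big.compose[OF exp_cubic_remainder, of E "at_right 0"] lim
    by (simp add: R_def E_def)
  also have "(\<lambda>q. E q ^ 4) \<in> O[at_right 0](\<lambda>q. q ^ 4)"
    using E by (rule landau_o.big_power)
  finally have "(\<lambda>q. R (E q)) \<in> O[at_right 0](\<lambda>q. q ^ 4)" .
  moreover have "A \<in> O[at_right 0](\<lambda>_. 1)"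
    unfolding A_def by real_asymp
  ultimately have rem: "(\<lambda>q. A q * R (E q)) \<in> O[at_right 0](\<lambda>q. q ^ 4)"
    using landau_o.big.mult[of A _ "\<lambda>_. 1" "\<lambda>q. R (E q)" "\<lambda>q. q ^ 4"] by simp
  have c: "(\<lambda>q. A q - 1 - q\<^sup>2 / 2) \<in> O[at_right 0](\<lambda>q. q ^ 4)"
      "(\<lambda>q. A q * u q - q - 3 / 2 * q ^ 3) \<in> O[at_right 0](\<lambda>q. q ^ 4)"
      "(\<lambda>q. A q * v q - q\<^sup>2 / 2) \<in> O[at_right 0](\<lambda>q. q ^ 4)"
      "(\<lambda>q. A q * (u q)\<^sup>2 - q\<^sup>2) \<in> O[at_right 0](\<lambda>q. q ^ 4)"
      "(\<lambda>q. A q * u q * v q - q ^ 3 / 2) \<in> O[at_right 0](\<lambda>q. q ^ 4)"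
      "(\<lambda>q. A q * (v q)\<^sup>2) \<in> O[at_right 0](\<lambda>q. q ^ 4)"
      "(\<lambda>q. A q * u q ^ 3 - q ^ 3) \<in> O[at_right 0](\<lambda>q. q ^ 4)"
      "(\<lambda>q. A q * (u q)\<^sup>2 * v q) \<in> O[at_right 0](\<lambda>q. q ^ 4)"
      "(\<lambda>q. A q * u q * (v q)\<^sup>2) \<in> O[at_right 0](\<lambda>q. q ^ 4)"
      "(\<lambda>q. A q * v q ^ 3) \<in> O[at_right 0](\<lambda>q. q ^ 4)"
    unfolding A_def u_def v_def by real_asymp+
  have eq: "mehler q z w - (1 + q * (z * w) + q\<^sup>2 * ((z\<^sup>2 - 1) * (w\<^sup>2 - 1)) / 2
    + q ^ 3 * ((z ^ 3 - 3 * z) * (w ^ 3 - 3 * w)) / 6)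
    = A q * R (E q) + (A q - 1 - q\<^sup>2 / 2) + p * (A q * u q - q - 3 / 2 * q ^ 3)
      - s * (A q * v q - q\<^sup>2 / 2) + p\<^sup>2 / 2 * (A q * (u q)\<^sup>2 - q\<^sup>2)
      - p * s * (A q * u q * v q - q ^ 3 / 2) + s\<^sup>2 / 2 * (A q * (v q)\<^sup>2)
      + p ^ 3 / 6 * (A q * u q ^ 3 - q ^ 3) - p\<^sup>2 * s / 2 * (A q * (u q)\<^sup>2 * v q)
      + p * s\<^sup>2 / 2 * (A q * u q * (v q)\<^sup>2) - s ^ 3 / 6 * (A q * v q ^ 3)" for q
  proof -
    have "E q = (2 * q * z * w - q\<^sup>2 * (z\<^sup>2 + w\<^sup>2)) / (2 * (1 - q\<^sup>2))"
      unfolding E_def u_def v_def p_def s_def diff_divide_distrib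
      by (simp del: right_diff_distrib_numeral add: mult.commute mult.left_commute)
    then have m: "mehler q z w = A q * exp (E q)"
      by (simp add: mehler_def A_def)
    have h: "(z\<^sup>2 - 1) * (w\<^sup>2 - 1) = p\<^sup>2 - s + 1"
        "(z ^ 3 - 3 * z) * (w ^ 3 - 3 * w) = p ^ 3 - 3 * p * s + 9 * p"
      unfolding p_def s_def by algebra+
    show ?thesis
      unfolding m h p_def[symmetric]
      unfolding R_def E_def by (simp add: field_simps power2_eq_square power3_eq_cube)
  qed
  show ?thesis
    unfolding eq by (rule sum_in_bigo cmult_in_bigo rem c)+
qed

text \<open>A measure whose first three moments are those of the standard normal distribution annihilates
\<open>He\<^sub>1\<close>, \<open>He\<^sub>2\<close> and \<open>He\<^sub>3\<close>. As each Hermite term of the kernel is a product of a function of \<open>z\<close> and the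
same function of \<open>w\<close>, the orders one to three vanish from the quadratic form.\<close>
lemma moment_matched_mehler_form:
  fixes \<omega> z :: "'i \<Rightarrow> real"
  assumes m: "(\<Sum>i\<in>I. \<omega> i) = 1" "(\<Sum>i\<in>I. \<omega> i * z i) = 0" "(\<Sum>i\<in>I. \<omega> i * (z i)\<^sup>2) = 1"
    "(\<Sum>i\<in>I. \<omega> i * z i ^ 3) = 0"
  shows "(\<lambda>q. (\<Sum>i\<in>I. \<Sum>j\<in>I. \<omega> i * \<omega> j * mehler q (z i) (z j)) - 1) \<in> O[at_right 0](\<lambda>q. q ^ 4)"
proof -
  let ?P = "\<lambda>q i j. 1 + q * (z i * z j) + q\<^sup>2 * (((z i)\<^sup>2 - 1) * ((z j)\<^sup>2 - 1)) / 2
    + q ^ 3 * ((z i ^ 3 - 3 * z i) * (z j ^ 3 - 3 * z j)) / 6"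
  have h: "(\<Sum>i\<in>I. \<omega> i * ((z i)\<^sup>2 - 1)) = 0" "(\<Sum>i\<in>I. \<omega> i * (z i ^ 3 - 3 * z i)) = 0"
    using m
    by (simp_all add: right_diff_distrib sum_subtractf mult.left_commute[of _ 3] flip: sum_distrib_left)
  have "(\<Sum>i\<in>I. \<Sum>j\<in>I. \<omega> i * \<omega> j * ?P q i j) = 1" for q
  proof -
    have "(\<Sum>i\<in>I. \<Sum>j\<in>I. \<omega> i * \<omega> j * ?P q i j)
      = (\<Sum>i\<in>I. \<omega> i) * (\<Sum>j\<in>I. \<omega> j) + q * ((\<Sum>i\<in>I. \<omega> i * z i) * (\<Sum>j\<in>I. \<omega> j * z j))
        + q\<^sup>2 / 2 * ((\<Sum>i\<in>I. \<omega> i * ((z i)\<^sup>2 - 1)) * (\<Sum>j\<in>I. \<omega> j * ((z j)\<^sup>2 - 1)))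
        + q ^ 3 / 6 * ((\<Sum>i\<in>I. \<omega> i * (z i ^ 3 - 3 * z i)) * (\<Sum>j\<in>I. \<omega> j * (z j ^ 3 - 3 * z j)))"
      unfolding sum_product
      unfolding sum_distrib_left
      unfolding sum.distrib[symmetric]
      by (intro sum.cong refl) (simp add: algebra_simps add_divide_distrib diff_divide_distrib)
    then show ?thesis by (simp only: h m mult_zero_left mult_zero_right add_0_right mult_1)
  qed
  then have "(\<lambda>q. (\<Sum>i\<in>I. \<Sum>j\<in>I. \<omega> i * \<omega> j * mehler q (z i) (z j)) - 1)
    = (\<lambda>q. \<Sum>i\<in>I. \<Sum>j\<in>I. \<omega> i * \<omega> j * (mehler q (z i) (z j) - ?P q i j))"
    by (simp only: right_diff_distrib[of "_ * _" "mehler _ _ _"] sum_subtractf)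
  also have "\<dots> \<in> O[at_right 0](\<lambda>q. q ^ 4)"
    by (intro big_sum_in_bigo cmult_in_bigo mehler_expansion)
  finally show ?thesis .
qed

text \<open>Completing the square. With \<open>s\<^sup>2 = \<sigma>\<^sup>2 * (1 - q)\<close>, the normal density on the right has precision
\<open>2 / s\<^sup>2 - 1 / \<sigma>\<^sup>2\<close>, and the Mehler kernel collects the factor that is free of \<open>x\<close>.\<close>
lemma normal_density_mehler:
  assumes \<sigma>: "0 < \<sigma>" and q: "0 \<le> q" "q < 1"
  defines "s \<equiv> \<sigma> * sqrt (1 - q)"
  shows "normal_density (\<sigma> * sqrt q * z) s x * normal_density (\<sigma> * sqrt q * w) s x / normal_density 0 \<sigma> x
    = mehler q z w * normal_density (\<sigma> * sqrt q * (z + w) / (1 + q)) (\<sigma> * sqrt ((1 - q) / (1 + q))) x"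
proof -
  define t where "t = sqrt q"
  have t: "t\<^sup>2 = q" using q by (simp add: t_def)
  have s2: "s\<^sup>2 = \<sigma>\<^sup>2 * (1 - q)" and s'2: "(\<sigma> * sqrt ((1 - q) / (1 + q)))\<^sup>2 = \<sigma>\<^sup>2 * (1 - q) / (1 + q)"
    using q by (simp_all add: s_def power_mult_distrib)
  have fac: "1 - q\<^sup>2 = (1 - q) * (1 + q)" by algebra
  define y where "y = x / \<sigma>"
  have x: "x = \<sigma> * y" using \<sigma> by (simp add: y_def)
  have cancel: "(\<sigma> * r)\<^sup>2 / (2 * (\<sigma>\<^sup>2 * k)) = r\<^sup>2 / (2 * k)" for r k :: real
    using \<sigma> by (simp add: power_mult_distrib)
  have expo: "- (x - \<sigma> * t * z)\<^sup>2 / (2 * s\<^sup>2) + - (x - \<sigma> * t * w)\<^sup>2 / (2 * s\<^sup>2) - (- (x - 0)\<^sup>2 / (2 * \<sigma>\<^sup>2))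
    = (2 * q * z * w - q\<^sup>2 * (z\<^sup>2 + w\<^sup>2)) / (2 * (1 - q\<^sup>2))
      + - (x - \<sigma> * t * (z + w) / (1 + q))\<^sup>2 / (2 * (\<sigma>\<^sup>2 * (1 - q) / (1 + q)))"
  proof -
    have e: "x - \<sigma> * t * z = \<sigma> * (y - t * z)" "x - \<sigma> * t * w = \<sigma> * (y - t * w)" "x - 0 = \<sigma> * y"
      "x - \<sigma> * t * (z + w) / (1 + q) = \<sigma> * (y - t * (z + w) / (1 + q))"
      by (simp_all add: x algebra_simps)
    have g: "\<sigma>\<^sup>2 * (1 - q) / (1 + q) = \<sigma>\<^sup>2 * ((1 - q) / (1 + q))" "2 * \<sigma>\<^sup>2 = 2 * (\<sigma>\<^sup>2 * 1)" by simp_all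
    show ?thesis
      unfolding s2 e g minus_divide_left[symmetric] cancel fac
      using q
      apply (simp add: divide_simps)
      unfolding t[symmetric] by algebra
  qed
  have coef: "1 / sqrt (2 * pi * s\<^sup>2) * (1 / sqrt (2 * pi * s\<^sup>2)) / (1 / sqrt (2 * pi * \<sigma>\<^sup>2))
    = 1 / sqrt (1 - q\<^sup>2) * (1 / sqrt (2 * pi * (\<sigma>\<^sup>2 * (1 - q) / (1 + q))))"
  proof -
    define k l r where "k = sqrt (1 - q)" and "l = sqrt (1 + q)" and "r = sqrt (2 * pi)"
    have "k > 0" "l > 0" "r > 0" using q by (auto simp: k_def l_def r_def)
    moreover have "sqrt (2 * pi * s\<^sup>2) = r * \<sigma> * k" "sqrt (2 * pi * \<sigma>\<^sup>2) = r * \<sigma>"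
      "sqrt (2 * pi * (\<sigma>\<^sup>2 * (1 - q) / (1 + q))) = r * \<sigma> * k / l" "sqrt (1 - q\<^sup>2) = k * l"
      unfolding s2 fac using \<sigma> q by (simp_all add: real_sqrt_mult real_sqrt_divide k_def l_def r_def)
    ultimately show ?thesis using \<sigma> by simp
  qed
  have ratio: "(c * exp a) * (c * exp b) / (d * exp e) = (c * c / d) * exp (a + b - e)" for a b c d e :: real
    by (simp add: exp_add exp_diff)
  show ?thesis
    unfolding normal_density_def mehler_def s'2 t_def[symmetric] ratio expo coef exp_add
    by simp
qed

section \<open>Contamination that matches three moments\<close>

text \<open>Around the mean, put the two points at the roots \<open>x\<close> and \<open>y\<close> of \<open>t\<^sup>2 - K * t - V\<close>, where
\<open>V\<close> is the required variance and \<open>K * V\<close> the required third central moment. As \<open>V > 0\<close>, the roots have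
opposite signs, so the weights that balance them are nonnegative. These weights give the central second
moment \<open>- x * y\<close> and the central third moment \<open>- x * y * (x + y)\<close>.\<close>
lemma two_point_three_moments:
  fixes m1 m2 m3 :: real
  assumes "m1\<^sup>2 < m2"
  obtains p b c where "0 \<le> p" "p \<le> 1" "p * b + (1 - p) * c = m1"
    "p * b\<^sup>2 + (1 - p) * c\<^sup>2 = m2" "p * b ^ 3 + (1 - p) * c ^ 3 = m3"
proof -
  define V K where "V = m2 - m1\<^sup>2" and "K = (m3 - 3 * m1 * V - m1 ^ 3) / V"
  have V: "V > 0" using assms by (simp add: V_def)
  define d where "d = sqrt (K\<^sup>2 + 4 * V)"
  have "sqrt (K\<^sup>2) < d" unfolding d_def using V by (intro real_sqrt_less_mono) simp
  then have d: "\<bar>K\<bar> < d" by simp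
  have d2: "d\<^sup>2 = K\<^sup>2 + 4 * V" unfolding d_def using V by (simp add: add_nonneg_pos less_imp_le)
  define x y where "x = (K + d) / 2" and "y = (K - d) / 2"
  have sgn: "x > 0" "y < 0" using d by (auto simp: x_def y_def)
  have xy: "x * y = - V" "x + y = K"
    using d2 by (auto simp: x_def y_def power2_eq_square field_simps)
  define p where "p = - y / (x - y)"
  have p1: "1 - p = x / (x - y)" using sgn by (simp add: p_def field_simps)
  have a: "p * x + (1 - p) * y = 0" "p * x\<^sup>2 + (1 - p) * y\<^sup>2 = - (x * y)"
    "p * x ^ 3 + (1 - p) * y ^ 3 = - (x * y) * (x + y)"
    unfolding p1 unfolding p_def using sgn
    by (simp_all add: divide_simps, algebra+)
  have K: "V * K = m3 - 3 * m1 * V - m1 ^ 3" using V by (simp add: K_def)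
  show ?thesis
  proof
    show "0 \<le> p" "p \<le> 1" using sgn by (auto simp: p_def field_simps)
    show "p * (m1 + x) + (1 - p) * (m1 + y) = m1" using a(1) by algebra
    show "p * (m1 + x)\<^sup>2 + (1 - p) * (m1 + y)\<^sup>2 = m2"
      using a(1,2) xy V_def by algebra
    show "p * (m1 + x) ^ 3 + (1 - p) * (m1 + y) ^ 3 = m3"
      using a xy K by algebra
  qed
qed

text \<open>The mean, second and third moment of the contamination are forced by the atom at \<open>a\<close>, and a
contamination with these moments exists as soon as the implied variance is positive. The choice
\<open>a\<^sup>2 = \<epsilon> / (2 * (1 - \<epsilon>)\<^sup>2)\<close> makes that variance \<open>1 / (2 * \<epsilon>) - 1 / (2 * (1 - \<epsilon>))\<close>, which is positive
for \<open>\<epsilon> < 1/2\<close>.\<close>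
lemma contaminated_atom_matches_gaussian_moments:
  fixes \<epsilon> :: real
  assumes "0 < \<epsilon>" "\<epsilon> < 1/2"
  obtains a p b c where "0 < a" "0 \<le> p" "p \<le> 1"
    "(1 - \<epsilon>) * a + \<epsilon> * p * b + \<epsilon> * (1 - p) * c = 0"
    "(1 - \<epsilon>) * a\<^sup>2 + \<epsilon> * p * b\<^sup>2 + \<epsilon> * (1 - p) * c\<^sup>2 = 1"
    "(1 - \<epsilon>) * a ^ 3 + \<epsilon> * p * b ^ 3 + \<epsilon> * (1 - p) * c ^ 3 = 0"
proof -
  define a where "a = sqrt (\<epsilon> / 2) / (1 - \<epsilon>)"
  have a: "a > 0" and a2: "2 * (1 - \<epsilon>)\<^sup>2 * a\<^sup>2 = \<epsilon>" using assms by (simp_all add: a_def field_simps)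
  have "2 * ((1 - \<epsilon>) * a)\<^sup>2 < 2 * (\<epsilon> * (1 - (1 - \<epsilon>) * a\<^sup>2))"
  proof -
    have "2 * (1 - \<epsilon>) * (\<epsilon> * (1 - (1 - \<epsilon>) * a\<^sup>2)) - 2 * (1 - \<epsilon>) * ((1 - \<epsilon>) * a)\<^sup>2 = \<epsilon> * (1 - 2 * \<epsilon>)"
      (is "?l = _")
    proof -
      have "?l = 2 * (1 - \<epsilon>) * \<epsilon> - 2 * (1 - \<epsilon>)\<^sup>2 * a\<^sup>2" by algebra
      then show ?thesis unfolding a2 by algebra
    qed
    also have "\<dots> > 0" using assms by simp
    finally have "0 < (1 - \<epsilon>) * (2 * (\<epsilon> * (1 - (1 - \<epsilon>) * a\<^sup>2)) - 2 * ((1 - \<epsilon>) * a)\<^sup>2)"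
      by (simp add: algebra_simps)
    then show ?thesis using assms by (simp add: zero_less_mult_iff)
  qed
  then have "(- ((1 - \<epsilon>) * a) / \<epsilon>)\<^sup>2 < (1 - (1 - \<epsilon>) * a\<^sup>2) / \<epsilon>"
    using divide_strict_right_mono[of "((1 - \<epsilon>) * a)\<^sup>2" "\<epsilon> * (1 - (1 - \<epsilon>) * a\<^sup>2)" "\<epsilon>\<^sup>2"] assms
    by (simp add: power_divide power2_eq_square[of \<epsilon>])
  from two_point_three_moments[OF this, of "- ((1 - \<epsilon>) * a ^ 3) / \<epsilon>"]
  obtain p b c where p: "0 \<le> p" "p \<le> 1" and m: "p * b + (1 - p) * c = - ((1 - \<epsilon>) * a) / \<epsilon>"
    "p * b\<^sup>2 + (1 - p) * c\<^sup>2 = (1 - (1 - \<epsilon>) * a\<^sup>2) / \<epsilon>"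
    "p * b ^ 3 + (1 - p) * c ^ 3 = - ((1 - \<epsilon>) * a ^ 3) / \<epsilon>" .
  have "\<epsilon> * (p * b + (1 - p) * c) = - ((1 - \<epsilon>) * a)"
    "\<epsilon> * (p * b\<^sup>2 + (1 - p) * c\<^sup>2) = 1 - (1 - \<epsilon>) * a\<^sup>2"
    "\<epsilon> * (p * b ^ 3 + (1 - p) * c ^ 3) = - ((1 - \<epsilon>) * a ^ 3)"
    unfolding m using assms by simp_all
  with p a show ?thesis by (intro that[of a p b c]) algebra+
qed

section \<open>Two-groups models with two-point contamination\<close>

lemma prob_space_gaussian: "0 < s \<Longrightarrow> prob_space (gaussian \<theta> s)"
  unfolding gaussian_def by (rule prob_space_normal_density)

lemma sets_gaussian [simp, measurable_cong]: "sets (gaussian \<theta> s) = sets borel"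
  by (simp add: gaussian_def)

lemma gaussian_translate:
  assumes [measurable]: "A \<in> sets borel"
  shows "(\<integral>\<^sup>+y. indicator A (x + y) \<partial>gaussian 0 s) = emeasure (gaussian x s) A"
proof -
  have "emeasure (gaussian x s) A = (\<integral>\<^sup>+y. ennreal (normal_density x s y) * indicator A y \<partial>lborel)"
    unfolding gaussian_def by (rule emeasure_density) auto
  also have "\<dots> = (\<integral>\<^sup>+y. ennreal (normal_density x s (x + y)) * indicator A (x + y) \<partial>lborel)"
    using nn_integral_real_affine[of "\<lambda>y. ennreal (normal_density x s y) * indicator A y" 1 x] by simp
  also have "\<dots> = (\<integral>\<^sup>+y. indicator A (x + y) \<partial>gaussian 0 s)"
    unfolding gaussian_def by (subst nn_integral_density) (auto simp: normal_density_def)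
  finally show ?thesis ..
qed

definition two_point :: "real \<Rightarrow> real \<Rightarrow> real \<Rightarrow> real measure" where
  "two_point p b c = distr (bernoulli_pmf p) borel (\<lambda>h. if h then b else c)"

lemma sets_two_point [simp, measurable_cong]: "sets (two_point p b c) = sets borel"
  by (simp add: two_point_def)

lemma prob_space_two_point: "prob_space (two_point p b c)"
  unfolding two_point_def by (intro prob_space.prob_space_distr prob_space_measure_pmf) auto

lemma two_groups_two_point:
  assumes s: "0 < s" and e: "0 \<le> \<epsilon>" "\<epsilon> \<le> 1" and p: "0 \<le> p" "p \<le> 1"
  shows "two_groups a s \<epsilon> (two_point p b c) = density lborel (\<lambda>x.
    ennreal ((1 - \<epsilon>) * normal_density a s x + \<epsilon> * p * normal_density b s x
      + \<epsilon> * (1 - p) * normal_density c s x))"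
proof (rule measure_eqI)
  fix A assume "A \<in> sets (two_groups a s \<epsilon> (two_point p b c))"
  then have A [measurable]: "A \<in> sets borel" by (simp add: two_groups_def)
  have "emeasure (two_point p b c \<star> gaussian 0 s) A
      = (\<integral>\<^sup>+x. emeasure (gaussian x s) A \<partial>two_point p b c)"
    using s prob_space_two_point[of p b c] prob_space_gaussian[of s 0]
    by (simp add: convolution_emeasure' prob_space.finite_measure gaussian_translate)
  also have "\<dots> = (\<integral>\<^sup>+h. emeasure (gaussian (if h then b else c) s) A \<partial>bernoulli_pmf p)"
  proof -
    have "(\<lambda>x. emeasure (gaussian x s) A) \<in> borel_measurable borel"
      unfolding gaussian_def normal_density_def
      by (subst emeasure_density; measurable)
    then show ?thesis
      unfolding two_point_def by (subst nn_integral_distr) auto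
  qed
  also have "\<dots> = emeasure (gaussian b s) A * p + emeasure (gaussian c s) A * (1 - p)"
    using p by simp
  finally have *: "emeasure (two_groups a s \<epsilon> (two_point p b c)) A
    = ennreal (1 - \<epsilon>) * emeasure (gaussian a s) A
      + ennreal \<epsilon> * (emeasure (gaussian b s) A * p + emeasure (gaussian c s) A * (1 - p))"
    by (simp add: two_groups_def emeasure_mixture)
  have g: "emeasure (gaussian x s) A = (\<integral>\<^sup>+y. ennreal (normal_density x s y) * indicator A y \<partial>lborel)" for x
    unfolding gaussian_def by (rule emeasure_density) auto
  show "emeasure (two_groups a s \<epsilon> (two_point p b c)) A = emeasure (density lborel (\<lambda>x.
    ennreal ((1 - \<epsilon>) * normal_density a s x + \<epsilon> * p * normal_density b s x
      + \<epsilon> * (1 - p) * normal_density c s x))) A"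
  proof -
    have "ennreal ((1 - \<epsilon>) * normal_density a s y + \<epsilon> * p * normal_density b s y
        + \<epsilon> * (1 - p) * normal_density c s y) * indicator A y
      = ennreal (1 - \<epsilon>) * (ennreal (normal_density a s y) * indicator A y)
        + ennreal \<epsilon> * ((ennreal (normal_density b s y) * indicator A y) * ennreal p
          + (ennreal (normal_density c s y) * indicator A y) * ennreal (1 - p))" for y
    proof -
      have "0 \<le> (1 - \<epsilon>) * normal_density a s y" "0 \<le> \<epsilon> * p * normal_density b s y"
        "0 \<le> \<epsilon> * (1 - p) * normal_density c s y"
        using e p by auto
      then show ?thesis
        using e p by (simp add: ennreal_mult distrib_left distrib_right ac_simps)
    qed
    then show ?thesis
      unfolding * g using p
      by (subst emeasure_density) (auto simp: nn_integral_add nn_integral_cmult nn_integral_multc)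
  qed
qed (simp add: two_groups_def)

section \<open>Likelihood ratios of product measures\<close>

lemma PiM_density:
  assumes "finite I" and M: "product_sigma_finite M" "product_sigma_finite (\<lambda>i. density (M i) (f i))"
    and [measurable]: "\<And>i. i \<in> I \<Longrightarrow> f i \<in> borel_measurable (M i)"
  shows "PiM I (\<lambda>i. density (M i) (f i)) = density (PiM I M) (\<lambda>x. \<Prod>i\<in>I. f i (x i))"
proof (rule product_sigma_finite.PiM_eqI[OF M(2), symmetric])
  have sets: "sets (PiM I M) = sets (PiM I (\<lambda>i. density (M i) (f i)))"
    by (rule sets_PiM_cong) auto
  then show "sets (density (PiM I M) (\<lambda>x. \<Prod>i\<in>I. f i (x i))) = sets (PiM I (\<lambda>i. density (M i) (f i)))"
    by simp
  fix A assume "\<And>i. i \<in> I \<Longrightarrow> A i \<in> sets (density (M i) (f i))"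
  then have A [measurable]: "\<And>i. i \<in> I \<Longrightarrow> A i \<in> sets (M i)" by simp
  have [measurable]: "(\<lambda>x. \<Prod>i\<in>I. f i (x i)) \<in> borel_measurable (PiM I M)"
    by measurable
  have [measurable]: "PiE I A \<in> sets (PiM I M)"
    using A \<open>finite I\<close> by (intro sets_PiM_I_finite)
  have "emeasure (density (PiM I M) (\<lambda>x. \<Prod>i\<in>I. f i (x i))) (PiE I A)
    = (\<integral>\<^sup>+x. (\<Prod>i\<in>I. f i (x i)) * indicator (PiE I A) x \<partial>PiM I M)"
    by (rule emeasure_density) measurable
  also have "\<dots> = (\<integral>\<^sup>+x. (\<Prod>i\<in>I. f i (x i) * indicator (A i) (x i)) \<partial>PiM I M)"
  proof (rule nn_integral_cong)
    fix x assume "x \<in> space (PiM I M)"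
    then have "indicator (PiE I A) x = (\<Prod>i\<in>I. indicator (A i) (x i) :: ennreal)"
      using \<open>finite I\<close> by (auto simp: indicator_def space_PiM PiE_iff)
    then show "(\<Prod>i\<in>I. f i (x i)) * indicator (PiE I A) x = (\<Prod>i\<in>I. f i (x i) * indicator (A i) (x i))"
      by (simp add: prod.distrib)
  qed
  also have "\<dots> = (\<Prod>i\<in>I. \<integral>\<^sup>+x. f i x * indicator (A i) x \<partial>M i)"
    using \<open>finite I\<close> by (intro product_sigma_finite.product_nn_integral_prod[OF M(1)]) auto
  also have "\<dots> = (\<Prod>i\<in>I. emeasure (density (M i) (f i)) (A i))"
    by (intro prod.cong refl emeasure_density[symmetric]) auto
  finally show "emeasure (density (PiM I M) (\<lambda>x. \<Prod>i\<in>I. f i (x i))) (PiE I A)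
    = (\<Prod>i\<in>I. emeasure (density (M i) (f i)) (A i))" .
qed (fact assms)

text \<open>The likelihood ratio \<open>G\<close> of the sample is a product of independent factors, so its second moment is
\<open>K ^ n\<close>. The difference of the two probabilities is at most the first absolute moment of \<open>G - 1\<close>, which
is bounded by the square root of its second moment.\<close>
lemma product_density_event_bound:
  fixes g :: "'a \<Rightarrow> real"
  assumes M: "prob_space M" and g_nonneg: "\<And>x. 0 \<le> g x"
    and g: "has_bochner_integral M g 1" and g2: "has_bochner_integral M (\<lambda>x. (g x)\<^sup>2) K"
    and A [measurable]: "A \<in> sets (PiM {..<n} (\<lambda>_. M))"
  shows "measure (PiM {..<n} (\<lambda>_. density M g)) A
    \<le> measure (PiM {..<n} (\<lambda>_. M)) A + sqrt (K ^ n - 1)"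
proof -
  define P where "P = PiM {..<n} (\<lambda>_. M)"
  define G where "G = (\<lambda>x. \<Prod>i<n. g (x i))"
  interpret M: prob_space M by fact
  interpret product_prob_space "\<lambda>_. M" ..
  interpret PP: prob_space P unfolding P_def by (intro prob_space_PiM M)
  have [measurable]: "g \<in> borel_measurable M" and ig: "integrable M g" "integral\<^sup>L M g = 1"
    using g by (auto simp: has_bochner_integral_iff)
  have ig2: "integrable M (\<lambda>x. (g x)\<^sup>2)" "integral\<^sup>L M (\<lambda>x. (g x)\<^sup>2) = K"
    using g2 by (auto simp: has_bochner_integral_iff)
  have "prob_space (density M g)"
    using g g_nonneg by (intro prob_spaceI) (simp add: emeasure_density nn_integral_eq_integral ig)
  then have "product_prob_space (\<lambda>_. density M g)"
    by (intro product_prob_spaceI)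
  then have sf: "product_sigma_finite (\<lambda>_. density M g)"
    by (rule product_prob_space.axioms)
  have dens: "PiM {..<n} (\<lambda>_. density M g) = density P G"
    unfolding P_def G_def
    by (subst PiM_density[OF _ product_sigma_finite_axioms sf]) (auto simp: prod_ennreal g_nonneg)
  have [measurable]: "A \<in> sets P" by (simp add: P_def)
  have G: "integrable P G" "integral\<^sup>L P G = 1"
    unfolding P_def G_def using ig product_integral_prod[of "{..<n}" "\<lambda>_. g"]
    by (auto intro!: product_integrable_prod)
  have G2: "integrable P (\<lambda>x. (G x)\<^sup>2)" "integral\<^sup>L P (\<lambda>x. (G x)\<^sup>2) = K ^ n"
    unfolding P_def G_def prod_power_distrib using ig2 product_integral_prod[of "{..<n}" "\<lambda>_ x. (g x)\<^sup>2"]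
    by (auto intro!: product_integrable_prod)
  have [measurable]: "G \<in> borel_measurable P" using G by auto
  have G_nonneg: "0 \<le> G x" for x unfolding G_def by (intro prod_nonneg) (simp add: g_nonneg)
  have iGA: "integrable P (\<lambda>x. G x * indicator A x)"
    using G by (rule_tac integrable_mult_indicator[of A P G, simplified mult.commute[of "indicator _ _"] real_scaleR_def]) auto
  have iA: "integrable P (indicator A :: _ \<Rightarrow> real)"
    by (intro PP.integrable_const_bound[of _ 1]) (auto simp: indicator_def)
  have "emeasure (density P G) A = ennreal (\<integral>x. G x * indicator A x \<partial>P)"
    using G_nonneg iGA
    by (simp add: emeasure_density nn_integral_eq_integral[symmetric] ennreal_mult' ennreal_indicator)
  then have "measure (density P G) A = (\<integral>x. G x * indicator A x \<partial>P)"
    by (simp add: measure_def integral_nonneg_AE G_nonneg)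
  then have "measure (density P G) A - measure P A = (\<integral>x. G x * indicator A x - indicator A x \<partial>P)"
    using iGA iA by (subst Bochner_Integration.integral_diff) auto
  also have "\<dots> \<le> (\<integral>x. \<bar>G x - 1\<bar> \<partial>P)"
    using iGA iA G by (intro integral_mono) (auto split: split_indicator)
  also have "\<dots> \<le> sqrt (K ^ n - 1)"
  proof (rule real_le_rsqrt)
    have sq: "(G x - 1)\<^sup>2 = (G x)\<^sup>2 - 2 * G x + 1" for x by algebra
    have i: "integrable P (\<lambda>x. (G x - 1)\<^sup>2)" "(\<integral>x. (G x - 1)\<^sup>2 \<partial>P) = K ^ n - 1"
      unfolding sq using G G2 by (simp_all add: PP.prob_space)
    have "0 \<le> PP.variance (\<lambda>x. \<bar>G x - 1\<bar>)" by simp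
    also have "\<dots> = (\<integral>x. (G x - 1)\<^sup>2 \<partial>P) - (\<integral>x. \<bar>G x - 1\<bar> \<partial>P)\<^sup>2"
      using i G by (subst PP.variance_eq) auto
    finally show "(\<integral>x. \<bar>G x - 1\<bar> \<partial>P)\<^sup>2 \<le> K ^ n - 1" using i by simp
  qed
  finally show ?thesis by (simp add: dens P_def)
qed

text \<open>For probability weights, the second moment is one plus the chi-square divergence of the mixture
from \<open>gaussian 0 \<sigma>\<close>. The components have the smaller variance \<open>\<sigma>\<^sup>2 * (1 - q)\<close>, which leaves \<open>\<sigma>\<^sup>2 * q\<close>
to the mixing distribution.\<close>
lemma gaussian_location_mixture_square:
  fixes I :: "'i set" and \<omega> z :: "'i \<Rightarrow> real"
  assumes \<sigma>: "0 < \<sigma>" and q: "0 \<le> q" "q < 1"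
  defines "g \<equiv> \<lambda>x. (\<Sum>i\<in>I. \<omega> i * normal_density (\<sigma> * sqrt q * z i) (\<sigma> * sqrt (1 - q)) x) / normal_density 0 \<sigma> x"
  shows "has_bochner_integral (gaussian 0 \<sigma>) g (\<Sum>i\<in>I. \<omega> i)"
    and "has_bochner_integral (gaussian 0 \<sigma>) (\<lambda>x. (g x)\<^sup>2) (\<Sum>i\<in>I. \<Sum>j\<in>I. \<omega> i * \<omega> j * mehler q (z i) (z j))"
proof -
  let ?s = "\<sigma> * sqrt (1 - q)"
  let ?f = "\<lambda>i. normal_density (\<sigma> * sqrt q * z i) ?s"
  have s: "?s > 0" "\<sigma> * sqrt ((1 - q) / (1 + q)) > 0" using \<sigma> q by auto
  have nz: "normal_density 0 \<sigma> x \<noteq> 0" for x using normal_density_pos[OF \<sigma>, of 0 x] by simp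
  have n1: "has_bochner_integral lborel (normal_density u v) 1" if "v > 0" for u v
    using that by (simp add: has_bochner_integral_iff)
  have [measurable]: "g \<in> borel_measurable borel" unfolding g_def by measurable
  have "has_bochner_integral lborel (\<lambda>x. \<Sum>i\<in>I. \<omega> i * ?f i x) (\<Sum>i\<in>I. \<omega> i * 1)"
    by (intro has_bochner_integral_sum has_bochner_integral_mult_right n1 s)
  then show "has_bochner_integral (gaussian 0 \<sigma>) g (\<Sum>i\<in>I. \<omega> i)"
    unfolding gaussian_def by (intro has_bochner_integral_density) (auto simp: g_def nz)
  have "has_bochner_integral lborel (\<lambda>x. \<Sum>i\<in>I. \<Sum>j\<in>I. \<omega> i * \<omega> j * (mehler q (z i) (z j)
      * normal_density (\<sigma> * sqrt q * (z i + z j) / (1 + q)) (\<sigma> * sqrt ((1 - q) / (1 + q))) x))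
      (\<Sum>i\<in>I. \<Sum>j\<in>I. \<omega> i * \<omega> j * (mehler q (z i) (z j) * 1))"
    by (intro has_bochner_integral_sum has_bochner_integral_mult_right n1 s)
  also have "(\<lambda>x. \<Sum>i\<in>I. \<Sum>j\<in>I. \<omega> i * \<omega> j * (mehler q (z i) (z j)
      * normal_density (\<sigma> * sqrt q * (z i + z j) / (1 + q)) (\<sigma> * sqrt ((1 - q) / (1 + q))) x))
    = (\<lambda>x. normal_density 0 \<sigma> x * (g x)\<^sup>2)"
  proof
    fix x
    have "normal_density 0 \<sigma> x * (g x)\<^sup>2
        = (\<Sum>i\<in>I. \<omega> i * ?f i x) * (\<Sum>j\<in>I. \<omega> j * ?f j x) / normal_density 0 \<sigma> x"
      using nz[of x] by (simp add: g_def power2_eq_square)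
    also have "\<dots> = (\<Sum>i\<in>I. \<Sum>j\<in>I. \<omega> i * \<omega> j * (?f i x * ?f j x / normal_density 0 \<sigma> x))"
      by (simp add: sum_product sum_divide_distrib ac_simps)
    finally show "(\<Sum>i\<in>I. \<Sum>j\<in>I. \<omega> i * \<omega> j * (mehler q (z i) (z j)
      * normal_density (\<sigma> * sqrt q * (z i + z j) / (1 + q)) (\<sigma> * sqrt ((1 - q) / (1 + q))) x))
      = normal_density 0 \<sigma> x * (g x)\<^sup>2"
      by (simp only: normal_density_mehler[OF \<sigma> q])
  qed
  finally show "has_bochner_integral (gaussian 0 \<sigma>) (\<lambda>x. (g x)\<^sup>2) (\<Sum>i\<in>I. \<Sum>j\<in>I. \<omega> i * \<omega> j * mehler q (z i) (z j))"
    unfolding gaussian_def by (intro has_bochner_integral_density) auto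
qed

section \<open>The lower bound\<close>

lemma diff_le_set_length:
  assumes "x \<in> I" "y \<in> I"
  shows "ereal (y - x) \<le> set_length I"
proof -
  have "ereal y - ereal x \<le> (SUP x\<in>I. ereal x) - (INF x\<in>I. ereal x)"
    using assms by (intro ereal_minus_mono SUP_upper INF_lower)
  with assms show ?thesis by (auto simp: set_length_def)
qed

lemma le_nested_INF:
  fixes f :: "'a \<Rightarrow> 'b \<Rightarrow> 'c \<Rightarrow> 'd \<Rightarrow> real"
  assumes le: "L \<le> (INF a\<in>A. INF b\<in>B. INF c\<in>C. INF d\<in>D. f a b c d)"
    and nonneg: "\<And>a b c d. 0 \<le> f a b c d"
    and mem: "a \<in> A" "b \<in> B" "c \<in> C" "d \<in> D"
  shows "L \<le> f a b c d"
proof -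
  have ne: "B \<noteq> {}" "C \<noteq> {}" "D \<noteq> {}" using mem by auto
  have bdd: "bdd_below (h ` X)" if "\<And>x. 0 \<le> h x" for h :: "'x \<Rightarrow> real" and X
    using that by (intro bdd_belowI2[of _ 0])
  have n1: "0 \<le> (INF d\<in>D. f a b c d)" for a b c by (intro cINF_greatest ne nonneg)
  have n2: "0 \<le> (INF c\<in>C. INF d\<in>D. f a b c d)" for a b by (intro cINF_greatest ne n1)
  have n3: "0 \<le> (INF b\<in>B. INF c\<in>C. INF d\<in>D. f a b c d)" for a by (intro cINF_greatest ne n2)
  note le
  also have "(INF a\<in>A. INF b\<in>B. INF c\<in>C. INF d\<in>D. f a b c d) \<le> (INF b\<in>B. INF c\<in>C. INF d\<in>D. f a b c d)"
    by (intro cINF_lower bdd n3 mem)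
  also have "\<dots> \<le> (INF c\<in>C. INF d\<in>D. f a b c d)" by (intro cINF_lower bdd n2 mem)
  also have "\<dots> \<le> (INF d\<in>D. f a b c d)" by (intro cINF_lower bdd n1 mem)
  also have "\<dots> \<le> f a b c d" by (intro cINF_lower bdd nonneg mem)
  finally show ?thesis .
qed

text \<open>An error of order \<open>q ^ 4\<close> in one observation is of order \<open>1 / n\<close> when \<open>q\<close> is of order
\<open>n powr (-1/4)\<close>; over \<open>n\<close> observations it compounds to a bounded error that vanishes with \<open>h\<close>.\<close>
lemma small_scale_sequence:
  fixes S :: "real \<Rightarrow> real"
  assumes S: "(\<lambda>q. S q - 1) \<in> O[at_right 0](\<lambda>q. q ^ 4)" and \<eta>: "0 < \<eta>" "\<eta> < 1"
  obtains h where "0 < h" "h < 1" "\<And>n. 1 \<le> n \<Longrightarrow> S (h * real n powr (-1/4)) ^ n \<le> 1 + \<eta>"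
proof -
  obtain C where C: "C > 0" and "eventually (\<lambda>q. norm (S q - 1) \<le> C * norm (q ^ 4)) (at_right 0)"
    using landau_o.bigE[OF S] by blast
  then obtain d where d: "d > 0" and Sd: "\<And>q. 0 < q \<Longrightarrow> q < d \<Longrightarrow> norm (S q - 1) \<le> C * norm (q ^ 4)"
    by (auto simp: eventually_at_right_field)
  \<comment> \<open>The bound \<open>1 / 2\<close> ensures \<open>h ^ 4 \<le> h\<close>, so that the last bound gives \<open>C * q ^ 4 \<le> \<eta> / 2 / n\<close>;
      \<open>d / 2\<close> keeps \<open>q\<close> where the estimate of \<open>S q - 1\<close> holds.\<close>
  define h where "h = min (1 / 2) (min (d / 2) (\<eta> / (2 * C)))"
  have h: "0 < h" "h < 1" "h < d" "h \<le> \<eta> / (2 * C)" using d C \<eta> by (auto simp: h_def)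
  have "S (h * real n powr (-1/4)) ^ n \<le> 1 + \<eta>" if n: "1 \<le> n" for n
  proof -
    define q where "q = h * real n powr (-1/4)"
    have "real n powr (-1/4) \<le> 1" using n powr_mono[of "-1/4" 0 "real n"] by simp
    then have "q \<le> h" using h by (simp add: q_def mult_left_le)
    have q0: "q > 0" using h n by (simp add: q_def)
    have "(real n powr (-1/4)) ^ 4 = real n powr (-1)"
      using n powr_power[of "real n" "-1/4" 4] by simp
    then have "q ^ 4 = h ^ 4 / n"
      using n by (simp only: q_def power_mult_distrib) (simp add: powr_neg_one)
    also have "\<dots> \<le> h / n" using h power_decreasing[of 1 4 h] by (intro divide_right_mono) simp_all
    finally have q4: "q ^ 4 \<le> h / n" .
    have "\<bar>S q - 1\<bar> \<le> C * q ^ 4" using Sd[of q] q0 \<open>q \<le> h\<close> h by simp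
    also have "\<dots> \<le> C * (\<eta> / (2 * C) / n)"
      using q4 h(4) C n by (intro mult_left_mono order_trans[OF q4] divide_right_mono) auto
    also have "\<dots> = \<eta> / 2 / n" using C by simp
    finally have S1: "\<bar>S q - 1\<bar> \<le> \<eta> / 2 / n" .
    have "\<eta> / 2 / n \<le> 1" using \<eta> n by (simp add: divide_simps)
    with S1 have "0 \<le> S q" by linarith
    moreover have "S q \<le> exp (\<eta> / 2 / n)" using S1 exp_ge_add_one_self[of "\<eta> / 2 / n"] by linarith
    ultimately have "S q ^ n \<le> exp (\<eta> / 2 / n) ^ n" by (intro power_mono)
    also have "\<dots> = exp (\<eta> / 2)" using n by (simp flip: exp_of_nat_mult)
    also have "\<dots> \<le> 1 + \<eta>" using real_exp_bound_lemma[of "\<eta> / 2"] \<eta> by simp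
    finally show ?thesis by (simp add: q_def)
  qed
  with h show ?thesis by (intro that)
qed

lemma (in prob_space) exists_in_three_events:
  assumes A: "A \<in> events" "B \<in> events" "C \<in> events"
    and p: "1 - \<alpha> \<le> prob A" "1 - \<beta> \<le> prob B" "1 - \<gamma> \<le> prob C" and "\<alpha> + \<beta> + \<gamma> < 1"
  obtains x where "x \<in> A" "x \<in> B" "x \<in> C"
proof -
  have "prob ((space M - A) \<union> (space M - B) \<union> (space M - C))
      \<le> prob (space M - A) + prob (space M - B) + prob (space M - C)"
    using A by (intro order_trans[OF measure_Un_le] add_right_mono measure_Un_le) auto
  also have "\<dots> < 1" using A assms(4-7) by (simp add: prob_compl)
  finally have "(space M - A) \<union> (space M - B) \<union> (space M - C) \<noteq> space M"
    using prob_space by auto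
  then show ?thesis using that A[THEN sets.sets_into_space] by auto
qed

text \<open>The alternative is a Gaussian mixture with locations \<open>\<sigma> * sqrt q * z i\<close> for the three moment-matching
points \<open>z i\<close> and component variance \<open>\<sigma>\<^sup>2 * (1 - q)\<close>. Its dominant atom is its centre. As \<open>q\<close> may be of
order \<open>n powr (-1/4)\<close>, that centre may be of order \<open>sqrt q\<close>, which is \<open>n powr (-1/8)\<close>.\<close>
lemma nearly_indistinguishable_alternative:
  fixes \<epsilon> \<eta> :: real
  assumes \<epsilon>: "0 < \<epsilon>" "\<epsilon> < 1/2" and \<eta>: "0 < \<eta>" "\<eta> < 1"
  obtains c where "0 < c"
    "\<And>n \<sigma>. 1 \<le> n \<Longrightarrow> 0 < \<sigma> \<Longrightarrow> \<exists>s>0. \<exists>Q\<in>space (prob_algebra borel).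
       \<forall>A\<in>sets (PiM {..<n} (\<lambda>_. borel)).
         measure (two_groups_sample n (c * \<sigma> * real n powr (-1/8)) s \<epsilon> Q) A
           \<le> measure (PiM {..<n} (\<lambda>_. gaussian 0 \<sigma>)) A + sqrt \<eta>"
proof -
  obtain a p b c where a: "0 < a" and p: "0 \<le> p" "p \<le> 1" and m:
    "(1 - \<epsilon>) * a + \<epsilon> * p * b + \<epsilon> * (1 - p) * c = 0"
    "(1 - \<epsilon>) * a\<^sup>2 + \<epsilon> * p * b\<^sup>2 + \<epsilon> * (1 - p) * c\<^sup>2 = 1"
    "(1 - \<epsilon>) * a ^ 3 + \<epsilon> * p * b ^ 3 + \<epsilon> * (1 - p) * c ^ 3 = 0"
    by (rule contaminated_atom_matches_gaussian_moments[OF \<epsilon>])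
  define \<omega> z :: "nat \<Rightarrow> real" where "\<omega> i = [1 - \<epsilon>, \<epsilon> * p, \<epsilon> * (1 - p)] ! i" and "z i = [a, b, c] ! i" for i
  have sum3: "(\<Sum>i<3. f i) = f 0 + f 1 + f 2" for f :: "nat \<Rightarrow> real"
    by (simp add: numeral_eq_Suc)
  have vals [simp]: "\<omega> 0 = 1 - \<epsilon>" "\<omega> (Suc 0) = \<epsilon> * p" "\<omega> 2 = \<epsilon> * (1 - p)" "z 0 = a" "z (Suc 0) = b" "z 2 = c"
    by (simp_all add: \<omega>_def z_def)
  have \<omega>1: "(\<Sum>i<3. \<omega> i) = 1" by (simp add: sum3 algebra_simps)
  define S where "S q = (\<Sum>i<3. \<Sum>j<3. \<omega> i * \<omega> j * mehler q (z i) (z j))" for q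
  have S: "(\<lambda>q. S q - 1) \<in> O[at_right 0](\<lambda>q. q ^ 4)"
    unfolding S_def using m by (intro moment_matched_mehler_form \<omega>1) (simp_all add: sum3)
  obtain h where h: "0 < h" "h < 1" and hS: "\<And>n. 1 \<le> n \<Longrightarrow> S (h * real n powr (-1/4)) ^ n \<le> 1 + \<eta>"
    using small_scale_sequence[OF S \<eta>] by blast
  show ?thesis
  proof
    show "0 < a * sqrt h" using a h by simp
    fix n :: nat and \<sigma> :: real assume n: "1 \<le> n" and \<sigma>: "0 < \<sigma>"
    define q where "q = h * real n powr (-1/4)"
    define s where "s = \<sigma> * sqrt (1 - q)"
    let ?u = "\<lambda>x. \<sigma> * sqrt q * x"
    define Q where "Q = two_point p (?u b) (?u c)"
    have "real n powr (-1/4) \<le> 1" using n powr_mono[of "-1/4" 0 "real n"] by simp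
    then have "q \<le> h" using h by (simp add: q_def mult_left_le)
    then have "q < 1" using h by simp
    have "0 < q" using h n by (simp add: q_def)
    have s: "s > 0" using \<open>q < 1\<close> \<sigma> by (simp add: s_def)
    have "sqrt q = sqrt h * real n powr (-1/8)"
      using n by (simp add: q_def real_sqrt_mult powr_half_sqrt[symmetric] powr_powr)
    then have \<theta>: "a * sqrt h * \<sigma> * real n powr (-1/8) = ?u a" by simp
    define g where "g = (\<lambda>x. (\<Sum>i<3. \<omega> i * normal_density (?u (z i)) s x) / normal_density 0 \<sigma> x)"
    have g_int: "has_bochner_integral (gaussian 0 \<sigma>) g 1"
        "has_bochner_integral (gaussian 0 \<sigma>) (\<lambda>x. (g x)\<^sup>2) (S q)"
      using gaussian_location_mixture_square[OF \<sigma> less_imp_le[OF \<open>0 < q\<close>] \<open>q < 1\<close>, of \<omega> z "{..<3}"] \<omega>1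
      by (simp_all add: g_def s_def S_def)
    have nonneg: "0 \<le> (\<Sum>i<3. \<omega> i * normal_density (?u (z i)) s x)" for x
      unfolding sum3 using p \<epsilon> by simp
    then have g_nonneg: "0 \<le> g x" for x by (simp add: g_def)
    have nz: "normal_density 0 \<sigma> x \<noteq> 0" for x using normal_density_pos[OF \<sigma>, of 0 x] by simp
    have "two_groups (?u a) s \<epsilon> Q = density lborel (\<lambda>x. ennreal (\<Sum>i<3. \<omega> i * normal_density (?u (z i)) s x))"
      unfolding Q_def sum3 using two_groups_two_point[OF s _ _ p, of \<epsilon> "?u a" "?u b" "?u c"] \<epsilon> by simp
    also have "\<dots> = density (gaussian 0 \<sigma>) g"
      unfolding gaussian_def
      using nz nonneg by (subst density_density_eq) (auto simp: g_def simp flip: ennreal_mult')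
    finally have alt: "two_groups (?u a) s \<epsilon> Q = density (gaussian 0 \<sigma>) g" .
    have "\<forall>A\<in>sets (PiM {..<n} (\<lambda>_. borel)). measure (two_groups_sample n (?u a) s \<epsilon> Q) A
           \<le> measure (PiM {..<n} (\<lambda>_. gaussian 0 \<sigma>)) A + sqrt \<eta>"
    proof
      fix A assume "A \<in> sets (PiM {..<n} (\<lambda>_. borel :: real measure))"
      then have A: "A \<in> sets (PiM {..<n} (\<lambda>_. gaussian 0 \<sigma>))"
        by (simp cong: sets_PiM_cong)
      have "sqrt (S q ^ n - 1) \<le> sqrt \<eta>" using hS[OF n] by (simp add: q_def)
      then show "measure (two_groups_sample n (?u a) s \<epsilon> Q) A
           \<le> measure (PiM {..<n} (\<lambda>_. gaussian 0 \<sigma>)) A + sqrt \<eta>"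
        unfolding two_groups_sample_def alt
        by (intro order_trans[OF product_density_event_bound[OF prob_space_gaussian[OF \<sigma>] g_nonneg g_int A]]
            add_left_mono)
    qed
    moreover have "Q \<in> space (prob_algebra borel)"
      by (simp add: Q_def space_prob_algebra prob_space_two_point)
    ultimately show "\<exists>s>0. \<exists>Q\<in>space (prob_algebra borel). \<forall>A\<in>sets (PiM {..<n} (\<lambda>_. borel)).
         measure (two_groups_sample n (a * sqrt h * \<sigma> * real n powr (-1/8)) s \<epsilon> Q) A
           \<le> measure (PiM {..<n} (\<lambda>_. gaussian 0 \<sigma>)) A + sqrt \<eta>"
      unfolding \<theta> using s by blast
  qed
qed

text \<open>If all contaminating effects are zero, the data are Gaussian for every contamination level. This is
how one null distribution serves all values of \<open>\<epsilon>\<close>.\<close>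
lemma two_groups_null_effects:
  assumes "0 < \<sigma>" "0 \<le> \<epsilon>" "\<epsilon> \<le> 1"
  shows "two_groups 0 \<sigma> \<epsilon> (two_point 1 0 0) = gaussian 0 \<sigma>"
  using two_groups_two_point[OF assms, of 1 0 0 0] by (simp add: gaussian_def algebra_simps)

theorem theorem4:
  fixes \<delta> \<epsilon>max :: real
  assumes "0 < \<delta>" "\<delta> < 1/4" and "0 < \<epsilon>max" "\<epsilon>max \<le> 1/3"
  shows "\<exists>c>0. \<forall>n\<ge>1. \<forall>(CI :: (nat \<Rightarrow> real) \<Rightarrow> real set) (r :: nat \<Rightarrow> real \<Rightarrow> real \<Rightarrow> ereal).
    confidence_interval n CI \<longrightarrow>
    (INF \<theta>\<in>UNIV. INF \<sigma>\<in>{0<..}. INF \<epsilon>\<in>{0..\<epsilon>max}. INF Q\<in>space (prob_algebra borel).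
       \<P>(x in two_groups_sample n \<theta> \<sigma> \<epsilon> Q. \<theta> \<in> CI x)) \<ge> 1 - \<delta> \<longrightarrow>
    (INF \<theta>\<in>UNIV. INF \<sigma>\<in>{0<..}. INF \<epsilon>\<in>{0..\<epsilon>max}. INF Q\<in>space (prob_algebra borel).
       \<P>(x in two_groups_sample n \<theta> \<sigma> \<epsilon> Q. set_length (CI x) \<le> r n \<sigma> \<epsilon>)) \<ge> 1 - \<delta> \<longrightarrow>
    (\<forall>\<sigma>>0. \<forall>\<epsilon>\<in>{0..\<epsilon>max}. ereal (c * \<sigma> * real n powr (-1/8)) \<le> r n \<sigma> \<epsilon>)"
proof -
  have "0 < \<epsilon>max" "\<epsilon>max < 1/2" using assms by auto
  then obtain c where c: "0 < c" and alternative: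
    "\<And>n \<sigma>. 1 \<le> n \<Longrightarrow> 0 < \<sigma> \<Longrightarrow> \<exists>s>0. \<exists>Q\<in>space (prob_algebra borel).
       \<forall>A\<in>sets (PiM {..<n} (\<lambda>_. borel)).
         measure (two_groups_sample n (c * \<sigma> * real n powr (-1/8)) s \<epsilon>max Q) A
           \<le> measure (PiM {..<n} (\<lambda>_. gaussian 0 \<sigma>)) A + sqrt (1/16)"
    \<comment> \<open>The three events below miss probabilities \<open>\<delta>\<close>, \<open>\<delta>\<close> and \<open>\<delta> + sqrt (1/16)\<close>, less than one in
        total because \<open>\<delta> < 1/4\<close>.\<close>
    by (rule nearly_indistinguishable_alternative[of \<epsilon>max "1/16"]) auto
  have "ereal (c * \<sigma> * real n powr (-1/8)) \<le> r n \<sigma> \<epsilon>"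
    if n: "1 \<le> n" and CI: "confidence_interval n CI"
      and cover: "(INF \<theta>\<in>UNIV. INF \<sigma>\<in>{0<..}. INF \<epsilon>\<in>{0..\<epsilon>max}. INF Q\<in>space (prob_algebra borel).
       \<P>(x in two_groups_sample n \<theta> \<sigma> \<epsilon> Q. \<theta> \<in> CI x)) \<ge> 1 - \<delta>"
      and len: "(INF \<theta>\<in>UNIV. INF \<sigma>\<in>{0<..}. INF \<epsilon>\<in>{0..\<epsilon>max}. INF Q\<in>space (prob_algebra borel).
       \<P>(x in two_groups_sample n \<theta> \<sigma> \<epsilon> Q. set_length (CI x) \<le> r n \<sigma> \<epsilon>)) \<ge> 1 - \<delta>"
      and \<sigma>: "0 < \<sigma>" and \<epsilon>: "\<epsilon> \<in> {0..\<epsilon>max}"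
    for n CI \<sigma> \<epsilon> and r :: "nat \<Rightarrow> real \<Rightarrow> real \<Rightarrow> ereal"
  proof -
    define \<theta> where "\<theta> = c * \<sigma> * real n powr (-1/8)"
    define B where "B = PiM {..<n} (\<lambda>_. borel :: real measure)"
    define P0 where "P0 = PiM {..<n} (\<lambda>_. gaussian 0 \<sigma>)"
    obtain s Q where s: "0 < s" and Q: "Q \<in> space (prob_algebra borel)" and close:
      "\<And>A. A \<in> sets B \<Longrightarrow> measure (two_groups_sample n \<theta> s \<epsilon>max Q) A \<le> measure P0 A + 1/4"
      using alternative[OF n \<sigma>] by (auto simp: \<theta>_def B_def P0_def real_sqrt_divide)
    have sets: "sets P0 = sets B" "space P0 = space B"
      "sets (two_groups_sample n \<theta> s \<epsilon>max Q) = sets B" "space (two_groups_sample n \<theta> s \<epsilon>max Q) = space B"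
      unfolding P0_def B_def two_groups_sample_def
      by (auto intro!: sets_PiM_cong sets_eq_imp_space_eq simp: two_groups_def)
    have null: "two_groups_sample n 0 \<sigma> \<epsilon> (two_point 1 0 0) = P0"
      using \<epsilon> assms \<sigma> by (simp add: two_groups_sample_def P0_def two_groups_null_effects)
    have Q0: "two_point 1 0 0 \<in> space (prob_algebra borel)"
      by (simp add: space_prob_algebra prob_space_two_point)
    interpret P0: prob_space P0
      unfolding P0_def by (intro prob_space_PiM prob_space_gaussian \<sigma>)
    let ?cov = "\<lambda>\<mu>. {x \<in> space B. \<mu> \<in> CI x}" and ?len = "{x \<in> space B. set_length (CI x) \<le> r n \<sigma> \<epsilon>}"
    have meas: "?cov \<mu> \<in> sets B" "?len \<in> sets B" for \<mu>
    proof -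
      have [measurable]: "(\<lambda>x. set_length (CI x)) \<in> borel_measurable B" "Measurable.pred B (\<lambda>x. \<mu> \<in> CI x)"
        using CI by (auto simp: confidence_interval_def B_def)
      show "?cov \<mu> \<in> sets B" "?len \<in> sets B" by measurable
    qed
    have p1: "1 - \<delta> \<le> P0.prob (?cov 0)"
      using le_nested_INF[OF cover measure_nonneg, of 0 \<sigma> \<epsilon> "two_point 1 0 0"] \<sigma> \<epsilon> Q0
      by (simp add: null sets)
    have p2: "1 - \<delta> \<le> P0.prob ?len"
      using le_nested_INF[OF len measure_nonneg, of 0 \<sigma> \<epsilon> "two_point 1 0 0"] \<sigma> \<epsilon> Q0
      by (simp add: null sets)
    have p3: "1 - (\<delta> + 1/4) \<le> P0.prob (?cov \<theta>)"
      using le_nested_INF[OF cover measure_nonneg, of \<theta> s \<epsilon>max Q] s Q assms close[OF meas(1), of \<theta>]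
      by (simp add: sets)
    have events: "?cov \<mu> \<in> P0.events" "?len \<in> P0.events" for \<mu>
      using meas by (simp_all only: sets)
    have "\<delta> + \<delta> + (\<delta> + 1/4) < 1" using assms by simp
    then obtain x where "x \<in> ?cov 0" "x \<in> ?len" "x \<in> ?cov \<theta>"
      using P0.exists_in_three_events[OF events(1) events(2) events(1) p1 p2 p3] by blast
    then have "ereal (\<theta> - 0) \<le> r n \<sigma> \<epsilon>"
      by (intro order_trans[OF diff_le_set_length]) auto
    then show ?thesis by (simp add: \<theta>_def)
  qed
  with c show ?thesis by blast
qed

end
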